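(* (One-touch case.) Let $F:\mathbb{R}^3\setminus\{\mathbf 0\}\to\mathbb{C}$ and $s:\mathbb{R}\setminus\{0\}\to\mathbb{C}$ satisfy $F(\alpha\mathbf r)=s(\alpha)F(\mathbf r)$ for all $\alpha\in\mathbb{R}\setminus\{0\}$ and $\mathbf r\neq\mathbf 0$. Let $\mathrm S$ be a triangle in $\mathbb{R}^3$ with vertices $\mathbf p_1,\mathbf p_2,\mathbf p_3$ and $\mathrm R$ a triangle in $\mathbb{R}^3$ with vertices $\mathbf q_1,\mathbf q_2,\mathbf q_3$, meeting exactly in the common vertex $\mathbf p_1=\mathbf q_1=\mathbf 0$. Assume that $(\mathbf x,\mathbf x')\mapsto F(\mathbf x-\mathbf x')$ is absolutely integrable over $\mathrm R\times\mathrm S$, and let $\mathbf p,\mathbf p'\in\mathbb{R}^3$. Let $1',2',3',4'$ and $1,2,3,4$ be the midpoint subdivisions of $\mathrm S$ and $\mathrm R$, and for each superscript $\bullet\in\{1,\mathbf p',\mathbf p,\mathbf p'\mathbf p\}$ put $I^\bullet=I^\bullet_{\mathrm S\mathrm R}$ and $$I^\bullet_{\mathrm{remainder}}=I^\bullet_{1'2}+I^\bullet_{1'3}+I^\bullet_{1'4}+I^\bullet_{2'\mathrm R}+I^\bullet_{3'\mathrm R}+I^\bullet_{4'\mathrm R}.$$ Then each of the following identities holds whenever the quantity inverted in it is nonzero: $$I^1=\left(1-\tfrac1{16}s\left(\tfrac12\right)\right)^{-1}I^1_{\mathrm{remainder}},$$ $$I^{\mathbf p'}=\left(1-\tfrac1{32}s\left(\tfrac12\right)\right)^{-1}I^{\mathbf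 p'}_{\mathrm{remainder}},$$ $$I^{\mathbf p}=\left(1-\tfrac1{32}s\left(\tfrac12\right)\right)^{-1}I^{\mathbf p}_{\mathrm{remainder}},$$ $$I^{\mathbf p'\mathbf p}=\left(1-\tfrac1{64}s\left(\tfrac12\right)\right)^{-1}I^{\mathbf p'\mathbf p}_{\mathrm{remainder}}.$$ Moreover, in each of the six pairs of triangles occurring in $I^\bullet_{\mathrm{remainder}}$ the two triangles are disjoint.
   Context: Triangles are closed and nondegenerate. For triangles $A,B\subset\mathbb{R}^3$ (source $A$, receiver $B$), with $dS$ denoting surface (area) measure, define $$I^1_{AB}=\int_{\mathbf x\in B}\int_{\mathbf x'\in A}F(\mathbf x-\mathbf x')\,dS(\mathbf x')\,dS(\mathbf x),$$ $$I^{\mathbf p'}_{AB}=\int_{\mathbf x\in B}\int_{\mathbf x'\in A}(\mathbf p'\cdot\mathbf x')F(\mathbf x-\mathbf x')\,dS(\mathbf x')\,dS(\mathbf x),$$ $$I^{\mathbf p}_{AB}=\int_{\mathbf x\in B}\int_{\mathbf x'\in A}(\mathbf p\cdot\mathbf x)F(\mathbf x-\mathbf x')\,dS(\mathbf x')\,dS(\mathbf x),$$ $$I^{\mathbf p'\mathbf p}_{AB}=\int_{\mathbf x\in B}\int_{\mathbf x'\in A}(\mathbf p'\cdot\mathbf x')(\mathbf p\cdot\mathbf x)F(\mathbf x-\mathbf x')\,dS(\mathbf x')\,dS(\mathbf x).$$ Midpoint subdivision: joining the midpoints of its edges divides $\mathrm S$ into four congruent triangles; for $i=1,2,3$, $i'$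 is the one containing the vertex $\mathbf p_i$ (its vertices are $\mathbf p_i$ and the midpoints of the two edges of $\mathrm S$ at $\mathbf p_i$), and $4'$ is the central one, whose vertices are the three edge midpoints. Likewise $\mathrm R$ is divided into $1,2,3$ (triangle $i$ containing $\mathbf q_i$) and the central triangle $4$. A subscript such as $2'\mathrm R$ means $A=2'$, $B=\mathrm R$. *)

theory Defs
  imports "HOL-Analysis.Analysis"
begin

type_synonym triangle = "(real^3) \<times> (real^3) \<times> (real^3)"

definition nondegenerate :: "triangle \<Rightarrow> bool" where
  "nondegenerate = (\<lambda>(a, b, c). \<not> collinear {a, b, c})"

definition triangle_set :: "triangle \<Rightarrow> (real^3) set" where
  "triangle_set = (\<lambda>(a, b, c). convex hull {a, b, c})"

definition reference_triangle :: "(real \<times> real) set" where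
  "reference_triangle = {(u, v). 0 \<le> u \<and> 0 \<le> v \<and> u + v \<le> 1}"

definition triangle_param :: "triangle \<Rightarrow> real \<times> real \<Rightarrow> real^3" where
  "triangle_param = (\<lambda>(a, b, c) (u, v). a + u *\<^sub>R (b - a) + v *\<^sub>R (c - a))"

text \<open>
  Surface area on a triangle, as a measure on the whole space concentrated on the triangle.
  The affine parametrization has constant partial derivatives \<open>b - a\<close> and \<open>c - a\<close>, so
  the area element is the norm of their cross product times Lebesgue measure in the parameters.
  The completion makes the measurable sets the Lebesgue (not just the Borel) ones.
\<close>

definition surface_measure :: "triangle \<Rightarrow> (real^3) measure" where
  "surface_measure T = (case T of (a, b, c) \<Rightarrow>
     completion
       (distr (scale_measure (ennreal (norm (cross3 (b - a) (c - a))))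
                 (restrict_space lborel reference_triangle))
              borel (triangle_param T)))"

text \<open>In the integrals below \<open>A\<close> is the source and \<open>B\<close> the receiver.\<close>

definition I_one :: "(real^3 \<Rightarrow> complex) \<Rightarrow> triangle \<Rightarrow> triangle \<Rightarrow> complex" where
  "I_one F A B =
     (\<integral>x. (\<integral>x'. F (x - x') \<partial>surface_measure A) \<partial>surface_measure B)"

definition I_src :: "real^3 \<Rightarrow> (real^3 \<Rightarrow> complex) \<Rightarrow> triangle \<Rightarrow> triangle \<Rightarrow> complex" where
  "I_src p' F A B =
     (\<integral>x. (\<integral>x'. complex_of_real (p' \<bullet> x') * F (x - x') \<partial>surface_measure A)
        \<partial>surface_measure B)"

definition I_rec :: "real^3 \<Rightarrow> (real^3 \<Rightarrow> complex) \<Rightarrow> triangle \<Rightarrow> triangle \<Rightarrow> complex" where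
  "I_rec p F A B =
     (\<integral>x. (\<integral>x'. complex_of_real (p \<bullet> x) * F (x - x') \<partial>surface_measure A)
        \<partial>surface_measure B)"

definition I_src_rec ::
    "real^3 \<Rightarrow> real^3 \<Rightarrow> (real^3 \<Rightarrow> complex) \<Rightarrow> triangle \<Rightarrow> triangle \<Rightarrow> complex" where
  "I_src_rec p' p F A B =
     (\<integral>x. (\<integral>x'. complex_of_real (p' \<bullet> x') * complex_of_real (p \<bullet> x) * F (x - x')
        \<partial>surface_measure A) \<partial>surface_measure B)"

definition sub1 :: "triangle \<Rightarrow> triangle" where
  "sub1 = (\<lambda>(a, b, c). (a, midpoint a b, midpoint a c))"

definition sub2 :: "triangle \<Rightarrow> triangle" where
  "sub2 = (\<lambda>(a, b, c). (b, midpoint a b, midpoint b c))"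

definition sub3 :: "triangle \<Rightarrow> triangle" where
  "sub3 = (\<lambda>(a, b, c). (c, midpoint a c, midpoint b c))"

definition sub4 :: "triangle \<Rightarrow> triangle" where
  "sub4 = (\<lambda>(a, b, c). (midpoint a b, midpoint b c, midpoint a c))"

definition remainder_pairs :: "triangle \<Rightarrow> triangle \<Rightarrow> (triangle \<times> triangle) list" where
  "remainder_pairs S R =
     [(sub1 S, sub2 R), (sub1 S, sub3 R), (sub1 S, sub4 R),
      (sub2 S, R), (sub3 S, R), (sub4 S, R)]"

definition remainder ::
    "(triangle \<Rightarrow> triangle \<Rightarrow> complex) \<Rightarrow> triangle \<Rightarrow> triangle \<Rightarrow> complex" where
  "remainder I S R = (\<Sum>(A, B)\<leftarrow>remainder_pairs S R. I A B)"

end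

theory Submission imports Defs begin

text \<open>
  Split the double integral over the sixteen pairs of subtriangles; all but the pair
  (\<open>sub1 S\<close>, \<open>sub1 R\<close>) at the common vertex make up the remainder. Since that vertex is the
  origin, the pair at it is the whole configuration scaled by one half. Each area element
  contributes a factor 1/4, \<open>F\<close> a factor \<open>s (1/2)\<close>, and each linear weight a factor 1/2, so the
  integral \<open>I\<close> satisfies \<open>I = \<kappa>/16 * s (1/2) * I + remainder\<close>, which is solved for \<open>I\<close>.

  For the splitting, integrals over a subtriangle are rewritten as integrals over the whole
  triangle weighted by an indicator function, so that every term is an integral of a bounded
  multiple of \<open>F (x - x')\<close> over the same product space. As the surface measures are completed,
  inner integrands need not be Borel, or even measurable for every \<open>x\<close>. The rewriting rules are
  therefore proved for arbitrary integrands, both sides taking the junk value 0 simultaneously.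
\<close>

subsection \<open>Integration against completed measures\<close>

text \<open>\<open>lebesgue_integral\<close> selects the value related to \<open>f\<close> by
  \<open>has_bochner_integral\<close>, or 0 if there is none. Equality of the two relations
  therefore covers the integrable and the junk case at once.\<close>

lemma integral_eq_if_has_bochner_integral_iff:
  assumes "\<And>I. has_bochner_integral M f I \<longleftrightarrow> has_bochner_integral N g I"
  shows "integral\<^sup>L M f = integral\<^sup>L N g"
proof -
  have "has_bochner_integral M f = has_bochner_integral N g" using assms by blast
  then show ?thesis by (simp only: lebesgue_integral_def)
qed

text \<open>Preimages under \<open>f\<close> and \<open>g\<close> differ only inside a null set, and
  the completion contains all subsets of null sets.\<close>

lemma borel_measurable_completion_AE_eq:
  assumes g: "g \<in> borel_measurable M" and eq: "AE x in M. f x = g x"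
  shows "f \<in> borel_measurable (completion M)"
proof (rule measurableI)
  fix A :: "'b set" assume A: "A \<in> sets borel"
  have "AE x in completion M. x \<in> g -` A \<inter> space (completion M) \<longleftrightarrow> x \<in> f -` A \<inter> space (completion M)"
    using eq by (simp only: AE_completion_iff) auto
  moreover have "g -` A \<inter> space (completion M) \<in> sets (completion M)"
    using measurable_sets[OF g A] by simp
  ultimately show "f -` A \<inter> space (completion M) \<in> sets (completion M)"
    by (rule completion.in_sets_AE) auto
qed simp

lemma completion_ex_borel_measurable_complex:
  fixes f :: "'a \<Rightarrow> complex"
  assumes "f \<in> borel_measurable (completion M)"
  shows "\<exists>g\<in>borel_measurable M. AE x in M. f x = g x"
proof -
  have "(\<lambda>x. Re (f x)) \<in> borel_measurable (completion M)" "(\<lambda>x. Im (f x)) \<in> borel_measurable (completion M)"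
    using assms by measurable
  from this[THEN completion_ex_borel_measurable_real] obtain u v where
    uv[measurable]: "u \<in> borel_measurable M" "v \<in> borel_measurable M"
    and eq: "AE x in M. Re (f x) = u x" "AE x in M. Im (f x) = v x" by blast
  show ?thesis
  proof (rule bexI)
    show "AE x in M. f x = Complex (u x) (v x)"
      using eq by eventually_elim (simp add: complex_eq_iff)
    show "(\<lambda>x. Complex (u x) (v x)) \<in> borel_measurable M"
      unfolding Complex_eq by measurable
  qed
qed

text \<open>Reduces integration against a completion to a representative measurable for the original
  measure. The rules below for density, image and product all work by transporting
  representatives.\<close>

lemma has_bochner_integral_completion_iff:
  fixes f :: "'a \<Rightarrow> complex"
  shows "has_bochner_integral (completion M) f I \<longleftrightarrow>
    (\<exists>g. has_bochner_integral M g I \<and> (AE x in M. f x = g x))"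
proof
  assume f: "has_bochner_integral (completion M) f I"
  then have fm: "f \<in> borel_measurable (completion M)"
    by (auto dest: borel_measurable_has_bochner_integral)
  then obtain g where g: "g \<in> borel_measurable M" and eq: "AE x in M. f x = g x"
    using completion_ex_borel_measurable_complex by blast
  have "has_bochner_integral (completion M) g I"
    using f by (rule has_bochner_integral_cong_AE[THEN iffD1, rotated -1])
      (use fm g eq in \<open>auto simp: AE_completion_iff intro: measurable_completion\<close>)
  then have "has_bochner_integral M g I"
    using g by (simp add: has_bochner_integral_iff integrable_completion integral_completion)
  with eq show "\<exists>g. has_bochner_integral M g I \<and> (AE x in M. f x = g x)" by blast
next
  assume "\<exists>g. has_bochner_integral M g I \<and> (AE x in M. f x = g x)"
  then obtain g where gI: "has_bochner_integral M g I" and eq: "AE x in M. f x = g x" by blast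
  then have g: "g \<in> borel_measurable M" by (auto dest: borel_measurable_has_bochner_integral)
  have "has_bochner_integral (completion M) g I"
    using gI g by (simp add: has_bochner_integral_iff integrable_completion integral_completion)
  then show "has_bochner_integral (completion M) f I"
    by (rule has_bochner_integral_cong_AE[THEN iffD1, rotated -1])
      (use g eq borel_measurable_completion_AE_eq[OF g eq] in
        \<open>auto simp: AE_completion_iff intro: measurable_completion\<close>)
qed

text \<open>Functions that agree almost everywhere have the same representatives, so they are
  integrable together and share the value.\<close>

lemma integral_completion_cong_AE:
  fixes f g :: "'a \<Rightarrow> complex"
  assumes "AE x in M. f x = g x"
  shows "integral\<^sup>L (completion M) f = integral\<^sup>L (completion M) g"
proof (rule integral_eq_if_has_bochner_integral_iff)
  have "(AE x in M. f x = h x) \<longleftrightarrow> (AE x in M. g x = h x)" for h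
    using assms by (auto elim: eventually_elim2)
  then show "has_bochner_integral (completion M) f I \<longleftrightarrow> has_bochner_integral (completion M) g I" for I
    by (simp add: has_bochner_integral_completion_iff)
qed

section \<open>Densities, images and products of completed measures\<close>

lemma integral_completion_density:
  fixes f :: "'a \<Rightarrow> complex" and h :: "'a \<Rightarrow> real"
  assumes h[measurable]: "h \<in> borel_measurable M" and nonneg: "\<And>x. 0 \<le> h x"
  shows "integral\<^sup>L (completion (density M h)) f = (\<integral>x. h x *\<^sub>R f x \<partial>completion M)"
proof (rule integral_eq_if_has_bochner_integral_iff)
  \<comment> \<open>The null sets of the density ignore the zeros of \<open>h\<close>, and
    multiplying by \<open>h\<close> erases the values there.\<close>
  have AE: "(AE x in density M h. f x = g x) \<longleftrightarrow> (AE x in M. h x *\<^sub>R f x = h x *\<^sub>R g x)" for g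
    using nonneg by (subst AE_density) (auto simp: less_le)
  have I: "has_bochner_integral (density M h) g I \<longleftrightarrow> has_bochner_integral M (\<lambda>x. h x *\<^sub>R g x) I"
    if "g \<in> borel_measurable M" for g :: "'a \<Rightarrow> complex" and I
    using that nonneg by (simp add: has_bochner_integral_iff integrable_density integral_density)
  fix I
  show "has_bochner_integral (completion (density M h)) f I \<longleftrightarrow>
      has_bochner_integral (completion M) (\<lambda>x. h x *\<^sub>R f x) I"
    unfolding has_bochner_integral_completion_iff AE
  proof safe
    fix g assume g: "has_bochner_integral (density M h) g I" "AE x in M. h x *\<^sub>R f x = h x *\<^sub>R g x"
    moreover have "g \<in> borel_measurable M"
      using borel_measurable_has_bochner_integral[OF g(1)] by simp
    ultimately show "\<exists>g. has_bochner_integral M g I \<and> (AE x in M. h x *\<^sub>R f x = g x)"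
      using I by blast
  next
    fix k assume k: "has_bochner_integral M k I" "AE x in M. h x *\<^sub>R f x = k x"
    have [measurable]: "k \<in> borel_measurable M"
      using borel_measurable_has_bochner_integral[OF k(1)] by simp
    \<comment> \<open>A representative \<open>k\<close> of \<open>h f\<close> is divided by
      \<open>h\<close> to give one of \<open>f\<close>. Where \<open>h\<close> vanishes,
      \<open>1 / h x\<close> is 0 by convention, and \<open>k\<close> is almost everywhere 0 there
      because it equals \<open>h f\<close>; so \<open>h ?g = k\<close> still holds almost
      everywhere.\<close>
    let ?g = "\<lambda>x. (1 / h x) *\<^sub>R k x"
    have hg: "AE x in M. h x *\<^sub>R ?g x = k x"
      using k(2) by eventually_elim auto
    have "has_bochner_integral M (\<lambda>x. h x *\<^sub>R ?g x) I"
      using k(1) by (rule has_bochner_integral_cong_AE[THEN iffD2, rotated -1]) (use hg in auto)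
    then have "has_bochner_integral (density M h) ?g I" by (subst I) auto
    moreover have "AE x in M. h x *\<^sub>R f x = h x *\<^sub>R ?g x"
      using k(2) hg by eventually_elim auto
    ultimately show "\<exists>g. has_bochner_integral (density M h) g I \<and> (AE x in M. h x *\<^sub>R f x = h x *\<^sub>R g x)"
      by blast
  qed
qed

text \<open>The measurable inverse \<open>T'\<close> turns a representative \<open>k\<close> of the
  composed function into the representative \<open>k o T'\<close> on the target space.\<close>

lemma integral_completion_distr:
  fixes f :: "'b \<Rightarrow> complex"
  assumes T[measurable]: "T \<in> measurable M N" and T'[measurable]: "T' \<in> measurable N M"
    and inv: "\<And>x. T' (T x) = x" "\<And>y. T (T' y) = y"
  shows "integral\<^sup>L (completion (distr M N T)) f = (\<integral>x. f (T x) \<partial>completion M)"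
proof (rule integral_eq_if_has_bochner_integral_iff)
  fix I
  show "has_bochner_integral (completion (distr M N T)) f I \<longleftrightarrow>
      has_bochner_integral (completion M) (\<lambda>x. f (T x)) I"
    unfolding has_bochner_integral_completion_iff
  proof safe
    fix g assume g: "has_bochner_integral (distr M N T) g I" "AE x in distr M N T. f x = g x"
    moreover have "g \<in> borel_measurable N"
      using borel_measurable_has_bochner_integral[OF g(1)] by simp
    ultimately show "\<exists>g. has_bochner_integral M g I \<and> (AE x in M. f (T x) = g x)"
      by (intro exI[of _ "\<lambda>x. g (T x)"])
        (auto simp: has_bochner_integral_iff integrable_distr_eq integral_distr dest: AE_distrD[OF T])
  next
    fix k assume k: "has_bochner_integral M k I" "AE x in M. f (T x) = k x"
    have [measurable]: "k \<in> borel_measurable M"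
      using borel_measurable_has_bochner_integral[OF k(1)] by simp
    \<comment> \<open>Since \<open>f\<close> is arbitrary, the exceptional set need not be
      measurable. Writing \<open>M\<close> as an image under \<open>T'\<close> lets the
      almost-everywhere statement be pulled back along \<open>T'\<close>.\<close>
    have "distr (distr M N T) M T' = M"
      by (subst distr_distr) (auto simp: comp_def inv distr_id2)
    with k(2) have "AE x in distr (distr M N T) M T'. f (T x) = k x" by (simp only:)
    then have "AE y in distr M N T. f (T (T' y)) = k (T' y)"
      by (rule AE_distrD[rotated]) simp
    then show "\<exists>g. has_bochner_integral (distr M N T) g I \<and> (AE x in distr M N T. f x = g x)"
      using k(1) by (intro exI[of _ "\<lambda>y. k (T' y)"])
        (auto simp: has_bochner_integral_iff integrable_distr_eq integral_distr inv)
  qed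
qed

text \<open>Fubini is applied to a representative \<open>g\<close> on the product. The factors are
  completed and their product is completed once more, matching the integrability hypothesis of the
  theorem.\<close>

lemma integral_completion_pair:
  fixes f :: "'a \<times> 'b \<Rightarrow> complex"
  assumes M: "sigma_finite_measure (completion M)" and N: "sigma_finite_measure (completion N)"
    and f: "integrable (completion (completion M \<Otimes>\<^sub>M completion N)) f"
  shows "(\<integral>x. \<integral>y. f (x, y) \<partial>completion N \<partial>completion M) =
    integral\<^sup>L (completion (completion M \<Otimes>\<^sub>M completion N)) f"
proof -
  interpret pair_sigma_finite "completion M" "completion N"
    using M N by (simp add: pair_sigma_finite_def)
  let ?P = "completion M \<Otimes>\<^sub>M completion N"
  have "has_bochner_integral (completion ?P) f (integral\<^sup>L (completion ?P) f)"
    using f by (simp add: has_bochner_integral_iff)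
  then obtain g where g: "has_bochner_integral ?P g (integral\<^sup>L (completion ?P) f)"
    and eq: "AE z in ?P. f z = g z"
    unfolding has_bochner_integral_completion_iff by blast
  \<comment> \<open>For almost every \<open>x\<close> the sections of \<open>f\<close> and
    \<open>g\<close> agree almost everywhere, so the inner integrals coincide; exceptional
    \<open>x\<close>, whose sections of \<open>f\<close> may be wild, form a null set for the outer
    integral.\<close>
  have "AE x in M. AE y in N. f (x, y) = g (x, y)"
    using AE_pair[OF eq] by (simp add: AE_completion_iff)
  then have "AE x in M. (\<integral>y. f (x, y) \<partial>completion N) = (\<integral>y. g (x, y) \<partial>completion N)"
    by eventually_elim (rule integral_completion_cong_AE)
  then have "(\<integral>x. \<integral>y. f (x, y) \<partial>completion N \<partial>completion M) =
      (\<integral>x. \<integral>y. g (x, y) \<partial>completion N \<partial>completion M)"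
    by (rule integral_completion_cong_AE)
  also have "\<dots> = integral\<^sup>L (completion ?P) f"
    using g by (simp add: has_bochner_integral_iff integral_fst')
  finally show ?thesis .
qed

subsection \<open>Surface measure of a triangle\<close>

text \<open>Tonelli reduces this to one-dimensional affine substitutions: first \<open>y\<close>
  becomes \<open>b + d * y\<close>, then, for fixed \<open>y\<close>, the shear term
  \<open>e * y\<close> is a mere translation of \<open>x\<close>. The second form swaps the output
  coordinates.\<close>

lemma nn_integral_lborel_shear:
  fixes f :: "real \<times> real \<Rightarrow> ennreal"
  assumes [measurable]: "f \<in> borel_measurable borel" and cd: "c \<noteq> 0" "d \<noteq> 0"
  shows "(\<integral>\<^sup>+z. f z \<partial>lborel) =
      ennreal \<bar>c * d\<bar> * (\<integral>\<^sup>+z. f (a + c * fst z + e * snd z, b + d * snd z) \<partial>lborel)" (is ?th1)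
    and "(\<integral>\<^sup>+z. f z \<partial>lborel) =
      ennreal \<bar>c * d\<bar> * (\<integral>\<^sup>+z. f (b + d * snd z, a + c * fst z + e * snd z) \<partial>lborel)" (is ?th2)
proof -
  have key: "(\<integral>\<^sup>+y. \<integral>\<^sup>+x. g x y \<partial>lborel \<partial>lborel) =
      ennreal \<bar>c * d\<bar> * (\<integral>\<^sup>+z. g (a + c * fst z + e * snd z) (b + d * snd z) \<partial>lborel)"
    if [measurable]: "(\<lambda>z. g (fst z) (snd z)) \<in> borel_measurable (borel \<Otimes>\<^sub>M borel)"
    for g :: "real \<Rightarrow> real \<Rightarrow> ennreal"
  proof -
    have [measurable]: "(\<lambda>x. g (u x) (v x)) \<in> borel_measurable M"
      if "u \<in> borel_measurable M" "v \<in> borel_measurable M" for u v and M :: "'z measure"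
      using measurable_compose[OF measurable_Pair[OF that] \<open>(\<lambda>z. g (fst z) (snd z)) \<in> _\<close>] by simp
    have "(\<integral>\<^sup>+y. \<integral>\<^sup>+x. g x y \<partial>lborel \<partial>lborel) =
        ennreal \<bar>d\<bar> * (\<integral>\<^sup>+y. \<integral>\<^sup>+x. g x (b + d * y) \<partial>lborel \<partial>lborel)"
      using cd by (subst nn_integral_real_affine[of _ d b]) auto
    also have "(\<integral>\<^sup>+y. \<integral>\<^sup>+x. g x (b + d * y) \<partial>lborel \<partial>lborel) =
        (\<integral>\<^sup>+y. ennreal \<bar>c\<bar> * (\<integral>\<^sup>+x. g (a + e * y + c * x) (b + d * y) \<partial>lborel) \<partial>lborel)"
      using cd by (intro nn_integral_cong nn_integral_real_affine) auto
    also have "\<dots> = ennreal \<bar>c\<bar> * (\<integral>\<^sup>+y. \<integral>\<^sup>+x. g (a + e * y + c * x) (b + d * y) \<partial>lborel \<partial>lborel)"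
      by (rule nn_integral_cmult) measurable
    also have "(\<integral>\<^sup>+y. \<integral>\<^sup>+x. g (a + e * y + c * x) (b + d * y) \<partial>lborel \<partial>lborel) =
        (\<integral>\<^sup>+z. g (a + c * fst z + e * snd z) (b + d * snd z) \<partial>(lborel \<Otimes>\<^sub>M lborel))"
      by (subst lborel_pair.nn_integral_snd[symmetric]) (auto simp: ac_simps)
    finally show ?thesis
      by (simp add: lborel_prod abs_mult ennreal_mult ac_simps)
  qed
  have [measurable]: "f \<in> borel_measurable (borel \<Otimes>\<^sub>M borel)"
    by (simp add: borel_prod)
  have m1: "(\<lambda>z. f (fst z, snd z)) \<in> borel_measurable (borel \<Otimes>\<^sub>M borel)"
    and m2: "(\<lambda>z. f (snd z, fst z)) \<in> borel_measurable (borel \<Otimes>\<^sub>M borel)"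
    by measurable
  show ?th1
    using key[of "\<lambda>x y. f (x, y)", OF m1] lborel_pair.nn_integral_snd[of f] by (simp add: lborel_prod borel_prod)
  show ?th2
    using key[of "\<lambda>x y. f (y, x)", OF m2] lborel.nn_integral_fst[of f lborel] by (simp add: lborel_prod borel_prod)
qed

section \<open>Surface measure before completion\<close>

definition double_area :: "triangle \<Rightarrow> real" where
  "double_area = (\<lambda>(a, b, c). norm (cross3 (b - a) (c - a)))"

text \<open>The surface measure without completion. Cutting off by a density instead of restricting
  the space keeps all measures on full spaces, with the Borel sets as measurable sets.\<close>

definition surface_borel :: "triangle \<Rightarrow> (real^3) measure" where
  "surface_borel T = distr (density lborel (\<lambda>w. ennreal (double_area T * indicator reference_triangle w)))
     borel (triangle_param T)"

lemma double_area_nonneg: "0 \<le> double_area T"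
  by (simp add: double_area_def split: prod.splits)

lemma triangle_param_eq:
  "triangle_param (a, b, c) w = a + fst w *\<^sub>R (b - a) + snd w *\<^sub>R (c - a)"
  by (simp add: triangle_param_def split: prod.splits)

lemma continuous_triangle_param: "continuous_on UNIV (triangle_param T)"
  by (cases T) (auto simp: triangle_param_eq[abs_def] intro!: continuous_intros)

lemma measurable_triangle_param[measurable]: "triangle_param T \<in> borel_measurable borel"
  using continuous_triangle_param by (rule borel_measurable_continuous_onI)

lemma triangle_set_eq_image: "triangle_set T = triangle_param T ` reference_triangle"
  by (cases T)
    (auto simp: triangle_set_def convex_hull_3_alt reference_triangle_def image_def triangle_param_eq)

lemma compact_triangle_set: "compact (triangle_set T)"
  by (cases T) (simp add: triangle_set_def compact_convex_hull)

lemma borel_triangle_set[measurable]: "triangle_set T \<in> sets borel"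
  using compact_triangle_set by (rule borel_compact)

lemma borel_reference_triangle[measurable]: "reference_triangle \<in> sets borel"
proof -
  have "reference_triangle = {w. 0 \<le> fst w} \<inter> {w. 0 \<le> snd w} \<inter> {w. fst w + snd w \<le> 1}"
    by (auto simp: reference_triangle_def)
  also have "closed \<dots>"
    by (intro closed_Int closed_Collect_le continuous_intros)
  finally show ?thesis by (rule borel_closed)
qed

lemma nn_integral_surface_borel:
  assumes [measurable]: "g \<in> borel_measurable borel"
  shows "(\<integral>\<^sup>+x. g x \<partial>surface_borel T) =
    ennreal (double_area T) * (\<integral>\<^sup>+w. indicator reference_triangle w * g (triangle_param T w) \<partial>lborel)"
  unfolding surface_borel_def
  by (subst nn_integral_distr, measurable, subst nn_integral_density, measurable)
    (simp add: nn_integral_cmult[symmetric] double_area_nonneg ennreal_mult ennreal_indicator ac_simps)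

lemma sets_surface_borel[simp, measurable_cong]: "sets (surface_borel T) = sets borel"
  by (simp add: surface_borel_def)

lemma space_surface_borel[simp]: "space (surface_borel T) = UNIV"
  by (simp add: surface_borel_def)

lemma emeasure_surface_borel:
  assumes [measurable]: "A \<in> sets borel"
  shows "emeasure (surface_borel T) A = ennreal (double_area T) *
    (\<integral>\<^sup>+w. indicator reference_triangle w * indicator A (triangle_param T w) \<partial>lborel)"
  using nn_integral_surface_borel[of "indicator A" T] by simp

text \<open>Both uncompleted measures give a Borel set \<open>A\<close> the value
  \<open>double_area T\<close> times the Lebesgue measure of its parameter set inside the reference
  triangle.\<close>

lemma surface_measure_eq: "surface_measure T = completion (surface_borel T)"
proof (cases T)
  case (fields a b c)
  have "distr (scale_measure (ennreal (norm (cross3 (b - a) (c - a))))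
      (restrict_space lborel reference_triangle)) borel (triangle_param T) = surface_borel T" (is "?D = _")
  proof (rule measure_eqI)
    fix A assume "A \<in> sets ?D"
    then have A[measurable]: "A \<in> sets borel" by simp
    have m: "triangle_param T \<in> measurable (restrict_space lborel reference_triangle) borel"
      by (rule measurable_restrict_space1) simp
    have "triangle_param T -` A \<inter> reference_triangle \<in> sets borel"
      using measurable_sets[OF measurable_triangle_param A, of T] by auto
    then have "emeasure ?D A = ennreal (double_area T) *
        emeasure lborel (triangle_param T -` A \<inter> reference_triangle)"
      using m by (subst emeasure_distr)
        (auto simp: double_area_def fields space_restrict_space emeasure_restrict_space
          measurable_def space_scale_measure sets_scale_measure)
    also have "emeasure lborel (triangle_param T -` A \<inter> reference_triangle) =
        (\<integral>\<^sup>+w. indicator (triangle_param T -` A \<inter> reference_triangle) w \<partial>lborel)"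
      using \<open>triangle_param T -` A \<inter> reference_triangle \<in> sets borel\<close> by simp
    also have "\<dots> = (\<integral>\<^sup>+w. indicator reference_triangle w * indicator A (triangle_param T w) \<partial>lborel)"
      by (intro nn_integral_cong) (auto simp: indicator_def)
    finally show "emeasure ?D A = emeasure (surface_borel T) A"
      by (simp add: emeasure_surface_borel)
  qed simp
  then show ?thesis
    by (simp add: surface_measure_def fields)
qed

text \<open>The condition \<open>double_area T \<noteq> 0\<close> on the right accounts for
  degenerate triangles, whose measure is zero.\<close>

lemma AE_surface_borel_iff:
  assumes [measurable]: "Measurable.pred borel P"
  shows "(AE x in surface_borel T. P x) \<longleftrightarrow>
    (AE w in lborel. double_area T \<noteq> 0 \<and> w \<in> reference_triangle \<longrightarrow> P (triangle_param T w))"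
  unfolding surface_borel_def
  by (subst AE_distr_iff, measurable, subst AE_density, measurable)
    (auto simp: ennreal_mult less_le double_area_nonneg indicator_def intro!: AE_cong)

lemma AE_surface_borel_triangle_set: "AE x in surface_borel T. x \<in> triangle_set T"
  by (subst AE_surface_borel_iff, measurable) (auto simp: triangle_set_eq_image)

lemma finite_surface_borel: "finite_measure (surface_borel T)"
proof (rule finite_measureI)
  have "reference_triangle \<subseteq> cbox (0, 0) (1, 1)"
    by (auto simp: reference_triangle_def cbox_Pair_eq)
  then have "emeasure lborel reference_triangle \<le> emeasure lborel (cbox (0::real, 0::real) (1, 1))"
    by (intro emeasure_mono) auto
  also have "\<dots> < \<infinity>"
    using emeasure_lborel_cbox_finite by blast
  finally have "emeasure lborel reference_triangle < \<infinity>" .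
  then show "emeasure (surface_borel T) (space (surface_borel T)) \<noteq> \<infinity>"
    by (simp add: emeasure_surface_borel ennreal_mult_eq_top_iff)
qed

lemma sigma_finite_surface_measure: "sigma_finite_measure (surface_measure T)"
proof -
  interpret finite_measure "surface_borel T" by (rule finite_surface_borel)
  have "finite_measure (surface_measure T)"
    using finite_emeasure_space by (intro finite_measureI) (simp add: surface_measure_eq)
  then show ?thesis by (rule finite_measure.axioms)
qed

lemma inj_triangle_param:
  assumes "double_area T \<noteq> 0"
  shows "inj (triangle_param T)"
proof (rule injI)
  fix w z assume eq: "triangle_param T w = triangle_param T z"
  obtain a b c where T: "T = (a, b, c)" by (cases T)
  have n: "cross3 (b - a) (c - a) \<noteq> 0" using assms by (simp add: double_area_def T)
  have d: "(fst w - fst z) *\<^sub>R (b - a) + (snd w - snd z) *\<^sub>R (c - a) = 0"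
    using eq by (simp add: T triangle_param_eq algebra_simps)
  \<comment> \<open>Crossing the vanishing combination with one edge removes that edge and isolates
    the coefficient of the other.\<close>
  have "(fst w - fst z) *\<^sub>R cross3 (b - a) (c - a) = 0"
    using arg_cong[OF d, of "\<lambda>x. cross3 x (c - a)"] by (simp only: cross_add_left cross_mult_left cross_refl) simp
  moreover have "(snd w - snd z) *\<^sub>R cross3 (b - a) (c - a) = 0"
    using arg_cong[OF d, of "\<lambda>x. cross3 (b - a) x"] by (simp only: cross_add_right cross_mult_right cross_refl) simp
  ultimately show "w = z" using n by (simp add: prod_eq_iff)
qed

lemma double_area_nonzero_iff: "double_area T \<noteq> 0 \<longleftrightarrow> nondegenerate T"
proof (cases T)
  case (fields a b c)
  \<comment> \<open>\<open>collinear_3\<close> takes differences to the second listed point, so the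
    base vertex \<open>a\<close> is moved there.\<close>
  have "collinear {a, b, c} \<longleftrightarrow> collinear {b, a, c}" by (simp add: insert_commute)
  then show ?thesis
    by (simp add: fields double_area_def nondegenerate_def cross_eq_0 collinear_3)
qed

text \<open>Needed because homogeneity constrains \<open>F\<close> only away from 0: the diagonal
  \<open>x = x'\<close> must be negligible. By injectivity a point has at most one parameter, and
  singletons are null.\<close>

lemma AE_surface_borel_neq: "AE x in surface_borel T. x \<noteq> y"
proof (subst AE_surface_borel_iff)
  show "AE w in lborel. double_area T \<noteq> 0 \<and> w \<in> reference_triangle \<longrightarrow> triangle_param T w \<noteq> y"
  proof (cases "double_area T \<noteq> 0 \<and> y \<in> range (triangle_param T)")
    case True
    then obtain z where z: "y = triangle_param T z" by blast
    have "AE w in lborel. w \<noteq> z" by (rule AE_lborel_singleton)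
    then show ?thesis
      by eventually_elim (use True z inj_triangle_param[of T] in \<open>auto dest: injD\<close>)
  qed auto
qed simp

text \<open>Treats the four subtriangles uniformly: \<open>\<phi>\<close> is the affine parameter
  map of \<open>T'\<close> relative to \<open>T\<close>, and its Jacobian 1/4 absorbs the area ratio
  1/4.\<close>

lemma surface_borel_eq_density:
  assumes area: "double_area T \<noteq> 0" "double_area T' = double_area T / 4"
    and sub: "triangle_set T' \<subseteq> triangle_set T"
    and param: "\<And>w. triangle_param T' w = triangle_param T (\<phi> w)"
    and \<phi>[measurable]: "\<phi> \<in> borel_measurable borel"
    and jacobian: "\<And>f. f \<in> borel_measurable borel \<Longrightarrow>
      (\<integral>\<^sup>+z. f z \<partial>lborel) = ennreal (1/4) * (\<integral>\<^sup>+z. f (\<phi> z) \<partial>lborel)"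
  shows "surface_borel T' = density (surface_borel T) (\<lambda>x. ennreal (indicator (triangle_set T') x))"
proof (rule measure_eqI)
  fix A assume "A \<in> sets (surface_borel T')"
  then have A[measurable]: "A \<in> sets borel" by simp
  \<comment> \<open>Injectivity on the whole plane allows indicators of the reference triangle and
    of the spatial triangle to be exchanged.\<close>
  have mem: "triangle_param U w \<in> triangle_set U \<longleftrightarrow> w \<in> reference_triangle"
    if "double_area U \<noteq> 0" for U w
    using inj_triangle_param[OF that] by (auto simp: triangle_set_eq_image inj_image_mem_iff)
  let ?B = "triangle_set T' \<inter> A"
  have "(\<integral>\<^sup>+w. indicator reference_triangle w * indicator A (triangle_param T' w) \<partial>lborel) =
      (\<integral>\<^sup>+w. indicator ?B (triangle_param T (\<phi> w)) \<partial>lborel)"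
    using mem[of T'] area by (intro nn_integral_cong) (auto simp: indicator_def param[symmetric])
  then have "emeasure (surface_borel T') A = ennreal (double_area T) *
      (ennreal (1/4) * (\<integral>\<^sup>+w. indicator ?B (triangle_param T (\<phi> w)) \<partial>lborel))"
    using double_area_nonneg[of T]
    by (simp add: emeasure_surface_borel area ennreal_mult[symmetric] mult.assoc[symmetric] del: ennreal_mult)
  also have "ennreal (1/4) * (\<integral>\<^sup>+w. indicator ?B (triangle_param T (\<phi> w)) \<partial>lborel) =
      (\<integral>\<^sup>+w. indicator ?B (triangle_param T w) \<partial>lborel)"
    by (rule jacobian[symmetric]) measurable
  also have "\<dots> = (\<integral>\<^sup>+w. indicator reference_triangle w * indicator ?B (triangle_param T w) \<partial>lborel)"
    using mem[of T] area sub by (intro nn_integral_cong) (auto simp: indicator_def)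
  also have "ennreal (double_area T) * \<dots> =
      (\<integral>\<^sup>+x. indicator (triangle_set T') x * indicator A x \<partial>surface_borel T)"
    by (subst nn_integral_surface_borel) (auto simp: indicator_inter_arith)
  also have "\<dots> = emeasure (density (surface_borel T) (\<lambda>x. ennreal (indicator (triangle_set T') x))) A"
    by (subst emeasure_density) (auto simp: ennreal_indicator)
  finally show "emeasure (surface_borel T') A =
      emeasure (density (surface_borel T) (\<lambda>x. ennreal (indicator (triangle_set T') x))) A" .
qed simp

subsection \<open>Midpoint subdivision\<close>

lemma double_area_sub:
  "double_area (sub1 T) = double_area T / 4" "double_area (sub2 T) = double_area T / 4"
  "double_area (sub3 T) = double_area T / 4" "double_area (sub4 T) = double_area T / 4"
proof -
  obtain a b c where T: "T = (a, b, c)" by (cases T)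
  let ?n = "cross3 (b - a) (c - a)"
  \<comment> \<open>The vertex order in \<open>sub2\<close> reverses the orientation, hence the
    minus sign; the norm removes it.\<close>
  have "cross3 (midpoint a b - a) (midpoint a c - a) = (1/4) *\<^sub>R ?n"
    "cross3 (midpoint a b - b) (midpoint b c - b) = (-1/4) *\<^sub>R ?n"
    "cross3 (midpoint a c - c) (midpoint b c - c) = (1/4) *\<^sub>R ?n"
    "cross3 (midpoint b c - midpoint a b) (midpoint a c - midpoint a b) = (1/4) *\<^sub>R ?n"
    by (simp_all add: cross3_simps midpoint_def forall_3) (simp_all add: field_simps)
  then show "double_area (sub1 T) = double_area T / 4" "double_area (sub2 T) = double_area T / 4"
    "double_area (sub3 T) = double_area T / 4" "double_area (sub4 T) = double_area T / 4"
    by (simp_all add: T double_area_def sub1_def sub2_def sub3_def sub4_def)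
qed

text \<open>The coordinate maps are kept in the literal shape of \<open>nn_integral_lborel_shear\<close>, hence the zero terms.\<close>

lemma triangle_param_sub:
  "triangle_param (sub1 T) w = triangle_param T (0 + 1/2 * fst w + 0 * snd w, 0 + 1/2 * snd w)"
  "triangle_param (sub2 T) w = triangle_param T (1 + (-1/2) * fst w + (-1/2) * snd w, 0 + 1/2 * snd w)"
  "triangle_param (sub3 T) w = triangle_param T (0 + 1/2 * snd w, 1 + (-1/2) * fst w + (-1/2) * snd w)"
  "triangle_param (sub4 T) w = triangle_param T (1/2 + (-1/2) * snd w, 0 + 1/2 * fst w + 1/2 * snd w)"
proof -
  obtain a b c where T: "T = (a, b, c)" by (cases T)
  show "triangle_param (sub1 T) w = triangle_param T (0 + 1/2 * fst w + 0 * snd w, 0 + 1/2 * snd w)"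
    "triangle_param (sub2 T) w = triangle_param T (1 + (-1/2) * fst w + (-1/2) * snd w, 0 + 1/2 * snd w)"
    "triangle_param (sub3 T) w = triangle_param T (0 + 1/2 * snd w, 1 + (-1/2) * fst w + (-1/2) * snd w)"
    "triangle_param (sub4 T) w = triangle_param T (1/2 + (-1/2) * snd w, 0 + 1/2 * fst w + 1/2 * snd w)"
    unfolding T sub1_def sub2_def sub3_def sub4_def triangle_param_eq midpoint_def prod.case
    by (simp_all only: vec_eq_iff vector_add_component vector_minus_component vector_scaleR_component
        real_scaleR_def fst_conv snd_conv) (intro allI; simp add: field_simps)+
qed

text \<open>Turns membership in a subtriangle into linear inequalities on the parameters. Inclusion,
  the partition of \<open>T\<close> and the avoidance of the first vertex are all read off from
  these.\<close>

lemma triangle_set_sub_eq_image: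
  "triangle_set (sub1 T) = triangle_param T ` {(u, v). 0 \<le> u \<and> 0 \<le> v \<and> u + v \<le> 1/2}"
  "triangle_set (sub2 T) = triangle_param T ` {(u, v). 1/2 \<le> u \<and> 0 \<le> v \<and> u + v \<le> 1}"
  "triangle_set (sub3 T) = triangle_param T ` {(u, v). 0 \<le> u \<and> 1/2 \<le> v \<and> u + v \<le> 1}"
  "triangle_set (sub4 T) = triangle_param T ` {(u, v). u \<le> 1/2 \<and> v \<le> 1/2 \<and> 1/2 \<le> u + v}"
proof -
  have eq: "triangle_set T' = triangle_param T ` Q"
    if "\<And>w. triangle_param T' w = triangle_param T (\<phi> w)"
      and "\<And>w. w \<in> reference_triangle \<Longrightarrow> \<phi> w \<in> Q"
      and "\<And>w. w \<in> Q \<Longrightarrow> \<psi> w \<in> reference_triangle \<and> \<phi> (\<psi> w) = w" for T' \<phi> \<psi> Q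
    unfolding triangle_set_eq_image
  proof safe
    fix w assume "w \<in> reference_triangle"
    then show "triangle_param T' w \<in> triangle_param T ` Q" using that(1,2) by auto
  next
    fix w assume "w \<in> Q"
    then show "triangle_param T w \<in> triangle_param T' ` reference_triangle"
      using that(1)[of "\<psi> w"] that(3)[of w] by (intro image_eqI[of _ _ "\<psi> w"]) auto
  qed
  \<comment> \<open>Each \<open>\<psi>\<close> below is the inverse of the corresponding affine map
    in \<open>triangle_param_sub\<close>.\<close>
  show "triangle_set (sub1 T) = triangle_param T ` {(u, v). 0 \<le> u \<and> 0 \<le> v \<and> u + v \<le> 1/2}"
    by (rule eq[OF triangle_param_sub(1), where \<psi> = "\<lambda>(u, v). (2 * u, 2 * v)"])
      (auto simp: reference_triangle_def)
  show "triangle_set (sub2 T) = triangle_param T ` {(u, v). 1/2 \<le> u \<and> 0 \<le> v \<and> u + v \<le> 1}"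
    by (rule eq[OF triangle_param_sub(2), where \<psi> = "\<lambda>(u, v). (2 - 2 * u - 2 * v, 2 * v)"])
      (auto simp: reference_triangle_def field_simps)
  show "triangle_set (sub3 T) = triangle_param T ` {(u, v). 0 \<le> u \<and> 1/2 \<le> v \<and> u + v \<le> 1}"
    by (rule eq[OF triangle_param_sub(3), where \<psi> = "\<lambda>(u, v). (2 - 2 * u - 2 * v, 2 * u)"])
      (auto simp: reference_triangle_def field_simps)
  show "triangle_set (sub4 T) = triangle_param T ` {(u, v). u \<le> 1/2 \<and> v \<le> 1/2 \<and> 1/2 \<le> u + v}"
    by (rule eq[OF triangle_param_sub(4), where \<psi> = "\<lambda>(u, v). (2 * u + 2 * v - 1, 1 - 2 * u)"])
      (auto simp: reference_triangle_def field_simps)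
qed

lemma triangle_set_sub_subset:
  "triangle_set (sub1 T) \<subseteq> triangle_set T" "triangle_set (sub2 T) \<subseteq> triangle_set T"
  "triangle_set (sub3 T) \<subseteq> triangle_set T" "triangle_set (sub4 T) \<subseteq> triangle_set T"
  by (simp_all only: triangle_set_sub_eq_image triangle_set_eq_image[of T])
    (rule image_mono, auto simp: reference_triangle_def)+

lemma surface_borel_sub:
  assumes "double_area T \<noteq> 0" and "T' \<in> {sub1 T, sub2 T, sub3 T, sub4 T}"
  shows "surface_borel T' = density (surface_borel T) (\<lambda>x. ennreal (indicator (triangle_set T') x))"
proof -
  note nz = assms(1)
  have jac: "(\<integral>\<^sup>+z. f z \<partial>lborel) = ennreal (1/4) *
        (\<integral>\<^sup>+z. f (a + c * fst z + e * snd z, b + d * snd z) \<partial>lborel)"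
      "(\<integral>\<^sup>+z. f z \<partial>lborel) = ennreal (1/4) *
        (\<integral>\<^sup>+z. f (b + d * snd z, a + c * fst z + e * snd z) \<partial>lborel)"
    if "\<bar>c * d\<bar> = 1/4" "f \<in> borel_measurable borel" for a b c d e and f :: "real \<times> real \<Rightarrow> ennreal"
  proof -
    have "c \<noteq> 0" "d \<noteq> 0" using that(1) by auto
    then show "(\<integral>\<^sup>+z. f z \<partial>lborel) = ennreal (1/4) *
        (\<integral>\<^sup>+z. f (a + c * fst z + e * snd z, b + d * snd z) \<partial>lborel)"
      "(\<integral>\<^sup>+z. f z \<partial>lborel) = ennreal (1/4) *
        (\<integral>\<^sup>+z. f (b + d * snd z, a + c * fst z + e * snd z) \<partial>lborel)"
      using nn_integral_lborel_shear[OF that(2), where a=a and b=b and c=c and d=d and e=e] that(1) by simp_all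
  qed
  have m: "(\<lambda>z::real \<times> real. (a + c * fst z + e * snd z, b + d * snd z)) \<in> borel_measurable borel"
    "(\<lambda>z::real \<times> real. (b + d * snd z, a + c * fst z + e * snd z)) \<in> borel_measurable borel"
    for a b c d e :: real
    by (auto intro!: borel_measurable_continuous_onI continuous_intros)
  \<comment> \<open>These are the values of \<open>c * d\<close> for \<open>sub1\<close>, for
    \<open>sub2\<close> and \<open>sub3\<close>, and for \<open>sub4\<close>. The maps of
    \<open>sub3\<close> and \<open>sub4\<close> fit the swapped form of the substitution.\<close>
  have "\<bar>1/2 * (1/2)\<bar> = (1/4::real)" "\<bar>(-1/2) * (1/2)\<bar> = (1/4::real)" "\<bar>1/2 * (-1/2)\<bar> = (1/4::real)"
    by simp_all
  note jac = jac(1)[OF this(1)] jac(1)[OF this(2)] jac(2)[OF this(2)] jac(2)[OF this(3)]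
  note area = double_area_sub[of T] and sub = triangle_set_sub_subset[of T]
  show ?thesis
    using assms(2)
  proof (elim insertE emptyE; hypsubst)
    show "surface_borel (sub1 T) = density (surface_borel T) (\<lambda>x. ennreal (indicator (triangle_set (sub1 T)) x))"
      by (rule surface_borel_eq_density[OF nz area(1) sub(1) triangle_param_sub(1) m(1) jac(1)])
    show "surface_borel (sub2 T) = density (surface_borel T) (\<lambda>x. ennreal (indicator (triangle_set (sub2 T)) x))"
      by (rule surface_borel_eq_density[OF nz area(2) sub(2) triangle_param_sub(2) m(1) jac(2)])
    show "surface_borel (sub3 T) = density (surface_borel T) (\<lambda>x. ennreal (indicator (triangle_set (sub3 T)) x))"
      by (rule surface_borel_eq_density[OF nz area(3) sub(3) triangle_param_sub(3) m(2) jac(3)])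
    show "surface_borel (sub4 T) = density (surface_borel T) (\<lambda>x. ennreal (indicator (triangle_set (sub4 T)) x))"
      by (rule surface_borel_eq_density[OF nz area(4) sub(4) triangle_param_sub(4) m(2) jac(4)])
  qed
qed

lemma integral_surface_measure_sub:
  fixes f :: "real^3 \<Rightarrow> complex"
  assumes "double_area T \<noteq> 0" and "T' \<in> {sub1 T, sub2 T, sub3 T, sub4 T}"
  shows "integral\<^sup>L (surface_measure T') f =
    (\<integral>x. indicator (triangle_set T') x *\<^sub>R f x \<partial>surface_measure T)"
  unfolding surface_measure_eq surface_borel_sub[OF assms]
  by (rule integral_completion_density) simp_all

text \<open>These three lines carry the edges shared by the closed subtriangles, the only places
  where they overlap.\<close>

lemma AE_lborel_avoids_midlines:
  "AE w in (lborel :: (real \<times> real) measure). fst w \<noteq> 1/2 \<and> snd w \<noteq> 1/2 \<and> fst w + snd w \<noteq> 1/2"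
proof -
  have "AE w in lborel \<Otimes>\<^sub>M lborel. fst w \<noteq> (1/2::real) \<and> snd w \<noteq> (1/2::real) \<and> fst w + snd w \<noteq> 1/2"
  proof (rule lborel_pair.AE_pair_measure)
    have "AE x in lborel. x \<noteq> (1/2::real)" by (rule AE_lborel_singleton)
    then show "AE x in lborel. AE y in lborel. fst (x, y) \<noteq> (1/2::real) \<and>
        snd (x, y) \<noteq> (1/2::real) \<and> fst (x, y) + snd (x, y) \<noteq> 1/2"
    proof eventually_elim
      fix x :: real assume x: "x \<noteq> 1/2"
      \<comment> \<open>Once \<open>x\<close> is off the vertical line, the other two lines exclude
        only two values of \<open>y\<close>.\<close>
      have "AE y in lborel. y \<noteq> (1/2::real)" "AE y in lborel. y \<noteq> (1/2 - x)"
        by (rule AE_lborel_singleton)+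
      then show "AE y in lborel. fst (x, y) \<noteq> 1/2 \<and> snd (x, y) \<noteq> (1/2::real) \<and> fst (x, y) + snd (x, y) \<noteq> 1/2"
        by eventually_elim (use x in auto)
    qed
  qed measurable
  then show ?thesis by (simp only: lborel_prod)
qed

text \<open>Off the midlines the inequalities of \<open>triangle_set_sub_eq_image\<close> select
  exactly one subtriangle.\<close>

lemma AE_sum_indicator_sub:
  assumes nz: "double_area T \<noteq> 0"
  shows "AE x in surface_borel T. indicator (triangle_set (sub1 T)) x + indicator (triangle_set (sub2 T)) x +
    indicator (triangle_set (sub3 T)) x + indicator (triangle_set (sub4 T)) x = (1::real)"
proof (subst AE_surface_borel_iff)
  note inj = inj_triangle_param[OF nz]
  show "AE w in lborel. double_area T \<noteq> 0 \<and> w \<in> reference_triangle \<longrightarrow>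
      indicator (triangle_set (sub1 T)) (triangle_param T w) + indicator (triangle_set (sub2 T)) (triangle_param T w) +
      indicator (triangle_set (sub3 T)) (triangle_param T w) + indicator (triangle_set (sub4 T)) (triangle_param T w) = (1::real)"
    using AE_lborel_avoids_midlines
    by eventually_elim
      (auto simp: triangle_set_sub_eq_image indicator_def inj_image_mem_iff[OF inj] reference_triangle_def)
qed measurable

section \<open>Scaling towards a vertex at the origin\<close>

lemma integral_surface_measure_sub1_vertex_0:
  fixes f :: "real^3 \<Rightarrow> complex"
  shows "integral\<^sup>L (surface_measure (sub1 (0, b, c))) f =
    (1/4) * (\<integral>x. f ((1/2) *\<^sub>R x) \<partial>surface_measure (0, b, c))"
proof -
  let ?T = "(0, b, c) :: triangle"
  let ?D = "distr (surface_borel ?T) borel (\<lambda>x. (1/2) *\<^sub>R x)"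
  have "surface_borel (sub1 ?T) = density ?D (\<lambda>_. ennreal (1/4))"
  proof (rule measure_eqI)
    fix A assume "A \<in> sets (surface_borel (sub1 ?T))"
    then have A[measurable]: "A \<in> sets borel" by simp
    \<comment> \<open>With the first vertex at the origin, halving carries one parametrization to
      the other at the same parameters; only the area constant changes.\<close>
    have "(1/2) *\<^sub>R triangle_param ?T w = triangle_param (sub1 ?T) w" for w
      by (simp add: triangle_param_eq sub1_def midpoint_def algebra_simps)
    then have "(\<integral>\<^sup>+x. indicator A ((1/2) *\<^sub>R x) \<partial>surface_borel ?T) = ennreal (double_area ?T) *
        (\<integral>\<^sup>+w. indicator reference_triangle w * indicator A (triangle_param (sub1 ?T) w) \<partial>lborel)"
      by (subst nn_integral_surface_borel) auto
    then have "emeasure (density ?D (\<lambda>_. ennreal (1/4))) A = ennreal (1/4) * (ennreal (double_area ?T) *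
        (\<integral>\<^sup>+w. indicator reference_triangle w * indicator A (triangle_param (sub1 ?T) w) \<partial>lborel))"
      by (simp add: emeasure_density nn_integral_cmult nn_integral_distr del: nn_integral_indicator)
    then show "emeasure (surface_borel (sub1 ?T)) A = emeasure (density ?D (\<lambda>_. ennreal (1/4))) A"
      by (simp add: emeasure_surface_borel double_area_sub mult.assoc[symmetric] ennreal_mult'[symmetric]
          double_area_nonneg)
  qed simp
  then have "integral\<^sup>L (surface_measure (sub1 ?T)) f = (\<integral>x. (1/4) *\<^sub>R f x \<partial>completion ?D)"
    by (simp only: surface_measure_eq) (rule integral_completion_density, simp_all)
  also have "\<dots> = (1/4) * (\<integral>x. f x \<partial>completion ?D)"
    by (simp add: scaleR_conv_of_real)
  also have "(\<integral>x. f x \<partial>completion ?D) = (\<integral>x. f ((1/2) *\<^sub>R x) \<partial>surface_measure ?T)"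
    unfolding surface_measure_eq
    by (rule integral_completion_distr[where T' = "\<lambda>x. 2 *\<^sub>R x"]) simp_all
  finally show ?thesis .
qed

section \<open>Disjointness away from the common vertex\<close>

lemma triangle_sets_disjoint:
  assumes "triangle_set S \<inter> triangle_set R = {0}"
    and "triangle_set A \<subseteq> triangle_set S" "triangle_set B \<subseteq> triangle_set R"
    and "0 \<notin> triangle_set A \<or> 0 \<notin> triangle_set B"
  shows "triangle_set A \<inter> triangle_set B = {}"
proof -
  have "triangle_set A \<inter> triangle_set B \<subseteq> {0}" using assms(1-3) by (metis Int_mono)
  then show ?thesis using assms(4) by auto
qed

text \<open>The first vertex has the unique parameters (0, 0), which violate a defining inequality
  of each of the other three subtriangles.\<close>

lemma first_vertex_notin_sub:
  assumes "double_area (a, b, c) \<noteq> 0"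
  shows "a \<notin> triangle_set (sub2 (a, b, c))" "a \<notin> triangle_set (sub3 (a, b, c))"
    "a \<notin> triangle_set (sub4 (a, b, c))"
proof -
  have "a = triangle_param (a, b, c) (0, 0)" by (simp add: triangle_param_eq)
  then have "a \<in> triangle_param (a, b, c) ` Q \<longleftrightarrow> (0, 0) \<in> Q" for Q
    using inj_image_mem_iff[OF inj_triangle_param[OF assms], of "(0, 0)" Q] by simp
  then show "a \<notin> triangle_set (sub2 (a, b, c))" "a \<notin> triangle_set (sub3 (a, b, c))"
    "a \<notin> triangle_set (sub4 (a, b, c))"
    by (simp_all add: triangle_set_sub_eq_image)
qed

subsection \<open>Interaction integrals\<close>

text \<open>Covers all four integrals by the choice of weight; \<open>w\<close> takes the receiver
  point first and the source point second.\<close>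

definition weighted_interaction ::
    "(real^3 \<Rightarrow> real^3 \<Rightarrow> complex) \<Rightarrow> (real^3 \<Rightarrow> complex) \<Rightarrow> triangle \<Rightarrow> triangle \<Rightarrow> complex" where
  "weighted_interaction w F A B =
     (\<integral>x. (\<integral>x'. w x x' * F (x - x') \<partial>surface_measure A) \<partial>surface_measure B)"

lemma weighted_interaction_sub1:
  assumes hom: "\<And>r. r \<noteq> 0 \<Longrightarrow> F ((1/2) *\<^sub>R r) = \<sigma> * F r"
    and w: "\<And>x x'. w ((1/2) *\<^sub>R x) ((1/2) *\<^sub>R x') = \<kappa> * w x x'"
  shows "weighted_interaction w F (sub1 (0, b, c)) (sub1 (0, d, e)) =
    \<kappa> * \<sigma> / 16 * weighted_interaction w F (0, b, c) (0, d, e)"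
proof -
  have "(\<integral>x'. w ((1/2) *\<^sub>R x) ((1/2) *\<^sub>R x') * F ((1/2) *\<^sub>R x - (1/2) *\<^sub>R x') \<partial>surface_measure (0, b, c)) =
      \<kappa> * \<sigma> * (\<integral>x'. w x x' * F (x - x') \<partial>surface_measure (0, b, c))" for x
  proof -
    \<comment> \<open>For fixed \<open>x\<close> the scaling law applies to \<open>x - x'\<close>
      except at \<open>x' = x\<close>, a null set.\<close>
    have "AE x' in surface_borel (0, b, c). w ((1/2) *\<^sub>R x) ((1/2) *\<^sub>R x') * F ((1/2) *\<^sub>R x - (1/2) *\<^sub>R x') =
        \<kappa> * \<sigma> * (w x x' * F (x - x'))"
      using AE_surface_borel_neq[where T = "(0, b, c)" and y = x]
    proof eventually_elim
      fix x' assume "x' \<noteq> x"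
      then show "w ((1/2) *\<^sub>R x) ((1/2) *\<^sub>R x') * F ((1/2) *\<^sub>R x - (1/2) *\<^sub>R x') = \<kappa> * \<sigma> * (w x x' * F (x - x'))"
        using hom[of "x - x'"] w[of x x'] by (simp only: scaleR_right_diff_distrib) simp
    qed
    then have "(\<integral>x'. w ((1/2) *\<^sub>R x) ((1/2) *\<^sub>R x') * F ((1/2) *\<^sub>R x - (1/2) *\<^sub>R x') \<partial>surface_measure (0, b, c)) =
        (\<integral>x'. \<kappa> * \<sigma> * (w x x' * F (x - x')) \<partial>surface_measure (0, b, c))"
      unfolding surface_measure_eq by (rule integral_completion_cong_AE)
    then show ?thesis by (simp only: integral_mult_right_zero)
  qed
  then show ?thesis
    by (simp add: weighted_interaction_def integral_surface_measure_sub1_vertex_0 del: scaleR_half_double)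
qed

lemma AE_surface_pair:
  assumes [measurable]: "Measurable.pred borel P" "Measurable.pred borel Q"
    and P: "AE x in surface_borel R. P x" and Q: "AE x in surface_borel S. Q x"
  shows "AE z in surface_measure R \<Otimes>\<^sub>M surface_measure S. P (fst z) \<and> Q (snd z)"
proof -
  interpret pair_sigma_finite "surface_measure R" "surface_measure S"
    by (simp add: pair_sigma_finite_def sigma_finite_surface_measure)
  have [measurable]: "Measurable.pred (surface_measure T) P" "Measurable.pred (surface_measure T) Q" for T
    by (simp_all add: surface_measure_eq) (rule measurable_completion, measurable)+
  show ?thesis
  proof (rule AE_pair_measure)
    have PQ: "AE x in surface_measure R. P x" "AE x in surface_measure S. Q x"
      unfolding surface_measure_eq AE_completion_iff by (rule P, rule Q)
    show "AE x in surface_measure R. AE y in surface_measure S. P (fst (x, y)) \<and> Q (snd (x, y))"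
      using PQ(1) by eventually_elim (use PQ(2) in simp)
  qed measurable
qed

text \<open>The receiver is split only against \<open>sub1 S\<close>; the other three source pieces
  keep all of \<open>R\<close>. This gives the corner pair and the six remainder pairs.\<close>

lemma weighted_interaction_remainder:
  fixes F :: "real^3 \<Rightarrow> complex" and w :: "real^3 \<Rightarrow> real^3 \<Rightarrow> complex"
  assumes S: "double_area S \<noteq> 0" and R: "double_area R \<noteq> 0"
    and int: "integrable (completion (surface_measure R \<Otimes>\<^sub>M surface_measure S)) (\<lambda>(x, x'). F (x - x'))"
    and w: "continuous_on UNIV (\<lambda>z. w (fst z) (snd z))"
  shows "weighted_interaction w F S R =
    weighted_interaction w F (sub1 S) (sub1 R) + remainder (weighted_interaction w F) S R"
proof -
  let ?P = "surface_measure R \<Otimes>\<^sub>M surface_measure S"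
  let ?g = "\<lambda>z. w (fst z) (snd z) * F (fst z - snd z)"
  let ?i = "\<lambda>T x. indicator (triangle_set T) x :: real"
  have id[measurable]: "(\<lambda>x. x) \<in> surface_measure T \<rightarrow>\<^sub>M borel" for T
    unfolding surface_measure_eq by (rule measurable_completion) (simp add: measurable_ident_sets)
  have fs[measurable]: "fst \<in> ?P \<rightarrow>\<^sub>M borel" "snd \<in> ?P \<rightarrow>\<^sub>M borel"
    by (rule measurable_compose[OF measurable_fst id], rule measurable_compose[OF measurable_snd id])
  have ind: "(\<lambda>z. ?i T (fst z)) \<in> borel_measurable ?P" "(\<lambda>z. ?i T (snd z)) \<in> borel_measurable ?P" for T
    by measurable
  have wm: "(\<lambda>z. w (fst z) (snd z)) \<in> borel_measurable (completion ?P)"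
    by (rule measurable_completion, rule borel_measurable_continuous_Pair[OF fs w])
  \<comment> \<open>A continuous weight is bounded on the compact product of the triangles, so a
    constant multiple of \<open>F\<close> dominates the weighted integrand.\<close>
  have "compact ((\<lambda>z. w (fst z) (snd z)) ` (triangle_set R \<times> triangle_set S))"
    by (intro compact_continuous_image continuous_on_subset[OF w] compact_Times compact_triangle_set) auto
  then obtain K where K: "\<And>x x'. x \<in> triangle_set R \<Longrightarrow> x' \<in> triangle_set S \<Longrightarrow> norm (w x x') \<le> K"
    by (fastforce dest: compact_imp_bounded simp: bounded_iff)
  have "AE z in ?P. fst z \<in> triangle_set R \<and> snd z \<in> triangle_set S"
    by (rule AE_surface_pair[OF _ _ AE_surface_borel_triangle_set AE_surface_borel_triangle_set]) measurable
  then have bound: "AE z in completion ?P. norm (?g z) \<le> norm (K *\<^sub>R F (fst z - snd z))"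
    unfolding AE_completion_iff
  proof eventually_elim
    fix z assume "fst z \<in> triangle_set R \<and> snd z \<in> triangle_set S"
    then have "norm (w (fst z) (snd z)) \<le> \<bar>K\<bar>" using K[of "fst z" "snd z"] by auto
    then show "norm (?g z) \<le> norm (K *\<^sub>R F (fst z - snd z))"
      by (simp add: norm_mult mult_right_mono)
  qed
  have F: "integrable (completion ?P) (\<lambda>z. F (fst z - snd z))"
    using int by (simp add: case_prod_beta')
  have g: "integrable (completion ?P) ?g"
    by (rule Bochner_Integration.integrable_bound[OF integrable_scaleR_right[OF F] _ bound])
      (intro borel_measurable_times wm borel_measurable_integrable[OF F])
  \<comment> \<open>Every term is \<open>J h\<close> for an indicator-type cutoff \<open>h\<close>
    with absolute value at most 1. Such cutoffs preserve integrability, so Fubini applies to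
    each.\<close>
  define J where "J h = (\<integral>z. h z *\<^sub>R ?g z \<partial>completion ?P)" for h :: "_ \<Rightarrow> real"
  have hg: "integrable (completion ?P) (\<lambda>z. h z *\<^sub>R ?g z)"
    if "h \<in> borel_measurable ?P" "\<And>z. \<bar>h z\<bar> \<le> 1" for h
  proof (rule Bochner_Integration.integrable_bound[OF g])
    show "(\<lambda>z. h z *\<^sub>R ?g z) \<in> borel_measurable (completion ?P)"
      by (rule borel_measurable_scaleR[OF measurable_completion[OF that(1)] borel_measurable_integrable[OF g]])
    show "AE z in completion ?P. norm (h z *\<^sub>R ?g z) \<le> norm (?g z)"
      using that(2) by (simp add: mult_left_le_one_le del: norm_mult)
  qed
  have J: "(\<integral>x. \<integral>x'. h (x, x') *\<^sub>R (w x x' * F (x - x')) \<partial>surface_measure S \<partial>surface_measure R) = J h"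
    if h: "h \<in> borel_measurable ?P" "\<And>z. \<bar>h z\<bar> \<le> 1" for h
    using integral_completion_pair[of "surface_borel R" "surface_borel S" "\<lambda>z. h z *\<^sub>R ?g z"] hg[OF h]
      sigma_finite_surface_measure
    by (simp add: J_def surface_measure_eq)
  have W: "weighted_interaction w F S R = J (\<lambda>_. 1)"
    using J[of "\<lambda>_. 1"] by (simp add: weighted_interaction_def)
  have W1: "weighted_interaction w F A R = J (\<lambda>z. ?i A (snd z))"
    if "A \<in> {sub1 S, sub2 S, sub3 S, sub4 S}" for A
    using J[of "\<lambda>z. ?i A (snd z)"] ind
    by (simp add: weighted_interaction_def integral_surface_measure_sub[OF S that])
  have W2: "weighted_interaction w F A B = J (\<lambda>z. ?i B (fst z) * ?i A (snd z))"
    if A: "A \<in> {sub1 S, sub2 S, sub3 S, sub4 S}" and B: "B \<in> {sub1 R, sub2 R, sub3 R, sub4 R}" for A B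
  proof -
    \<comment> \<open>The receiver indicator is constant in \<open>x'\<close> and moves into the
      inner integral.\<close>
    have "weighted_interaction w F A B =
        (\<integral>x. \<integral>x'. (?i B x * ?i A x') *\<^sub>R (w x x' * F (x - x')) \<partial>surface_measure S \<partial>surface_measure R)"
      unfolding weighted_interaction_def integral_surface_measure_sub[OF S A] integral_surface_measure_sub[OF R B]
      by (simp only: scaleR_scaleR[symmetric] integral_scaleR_right)
    also have "\<dots> = J (\<lambda>z. ?i B (fst z) * ?i A (snd z))"
      using J[of "\<lambda>z. ?i B (fst z) * ?i A (snd z)"] ind by (simp add: indicator_def)
    finally show ?thesis .
  qed
  have intB: "integrable (completion ?P) (\<lambda>z. (?i B (fst z) * ?i A (snd z)) *\<^sub>R ?g z)" for A B
    by (rule hg) (use ind in \<open>auto simp: indicator_def\<close>)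
  have intA: "integrable (completion ?P) (\<lambda>z. ?i A (snd z) *\<^sub>R ?g z)" for A
    by (rule hg) (use ind in \<open>auto simp: indicator_def\<close>)
  let ?sum = "\<lambda>T x. ?i (sub1 T) x + ?i (sub2 T) x + ?i (sub3 T) x + ?i (sub4 T) x"
  have "AE z in ?P. ?sum R (fst z) = 1 \<and> ?sum S (snd z) = 1"
    by (rule AE_surface_pair[OF _ _ AE_sum_indicator_sub[OF R] AE_sum_indicator_sub[OF S]]) measurable
  then have "AE z in ?P. 1 *\<^sub>R ?g z =
      (?i (sub1 R) (fst z) * ?i (sub1 S) (snd z)) *\<^sub>R ?g z + ((?i (sub2 R) (fst z) * ?i (sub1 S) (snd z)) *\<^sub>R ?g z +
      ((?i (sub3 R) (fst z) * ?i (sub1 S) (snd z)) *\<^sub>R ?g z + ((?i (sub4 R) (fst z) * ?i (sub1 S) (snd z)) *\<^sub>R ?g z +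
      (?i (sub2 S) (snd z) *\<^sub>R ?g z + (?i (sub3 S) (snd z) *\<^sub>R ?g z + ?i (sub4 S) (snd z) *\<^sub>R ?g z)))))"
  proof eventually_elim
    fix z assume z: "?sum R (fst z) = 1 \<and> ?sum S (snd z) = 1"
    \<comment> \<open>The partition of unity on \<open>S\<close>, with its \<open>sub1\<close> term
      multiplied by the partition of unity on \<open>R\<close>.\<close>
    have "1 = ?sum R (fst z) * ?i (sub1 S) (snd z) + ?i (sub2 S) (snd z) + ?i (sub3 S) (snd z) + ?i (sub4 S) (snd z)"
      using z by simp
    then show "1 *\<^sub>R ?g z =
      (?i (sub1 R) (fst z) * ?i (sub1 S) (snd z)) *\<^sub>R ?g z + ((?i (sub2 R) (fst z) * ?i (sub1 S) (snd z)) *\<^sub>R ?g z +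
      ((?i (sub3 R) (fst z) * ?i (sub1 S) (snd z)) *\<^sub>R ?g z + ((?i (sub4 R) (fst z) * ?i (sub1 S) (snd z)) *\<^sub>R ?g z +
      (?i (sub2 S) (snd z) *\<^sub>R ?g z + (?i (sub3 S) (snd z) *\<^sub>R ?g z + ?i (sub4 S) (snd z) *\<^sub>R ?g z)))))"
      by (simp only: scaleR_left_distrib[symmetric]) (simp only: distrib_right add.assoc)
  qed
  then have "J (\<lambda>_. 1) = (\<integral>z.
      (?i (sub1 R) (fst z) * ?i (sub1 S) (snd z)) *\<^sub>R ?g z + ((?i (sub2 R) (fst z) * ?i (sub1 S) (snd z)) *\<^sub>R ?g z +
      ((?i (sub3 R) (fst z) * ?i (sub1 S) (snd z)) *\<^sub>R ?g z + ((?i (sub4 R) (fst z) * ?i (sub1 S) (snd z)) *\<^sub>R ?g z +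
      (?i (sub2 S) (snd z) *\<^sub>R ?g z + (?i (sub3 S) (snd z) *\<^sub>R ?g z + ?i (sub4 S) (snd z) *\<^sub>R ?g z))))) \<partial>completion ?P)"
    unfolding J_def by (rule integral_completion_cong_AE)
  also have "\<dots> = J (\<lambda>z. ?i (sub1 R) (fst z) * ?i (sub1 S) (snd z)) + (J (\<lambda>z. ?i (sub2 R) (fst z) * ?i (sub1 S) (snd z)) +
      (J (\<lambda>z. ?i (sub3 R) (fst z) * ?i (sub1 S) (snd z)) + (J (\<lambda>z. ?i (sub4 R) (fst z) * ?i (sub1 S) (snd z)) +
      (J (\<lambda>z. ?i (sub2 S) (snd z)) + (J (\<lambda>z. ?i (sub3 S) (snd z)) + J (\<lambda>z. ?i (sub4 S) (snd z)))))))"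
    unfolding J_def
    by (simp only: Bochner_Integration.integral_add Bochner_Integration.integrable_add intA intB)
  finally show ?thesis
    by (simp add: W W1 W2 remainder_def remainder_pairs_def)
qed

text \<open>Self-similarity of the corner pair turns the splitting into a linear equation for the
  integral, solvable when its coefficient is nonzero.\<close>

lemma weighted_interaction_one_touch:
  fixes F :: "real^3 \<Rightarrow> complex" and w :: "real^3 \<Rightarrow> real^3 \<Rightarrow> complex"
  assumes S: "S = (0, b, c)" "nondegenerate S" and R: "R = (0, d, e)" "nondegenerate R"
    and hom: "\<And>r. r \<noteq> 0 \<Longrightarrow> F ((1/2) *\<^sub>R r) = \<sigma> * F r"
    and int: "integrable (completion (surface_measure R \<Otimes>\<^sub>M surface_measure S)) (\<lambda>(x, x'). F (x - x'))"
    and cont: "continuous_on UNIV (\<lambda>z. w (fst z) (snd z))"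
    and w: "\<And>x x'. w ((1/2) *\<^sub>R x) ((1/2) *\<^sub>R x') = \<kappa> * w x x'"
    and nz: "1 - \<kappa> / 16 * \<sigma> \<noteq> 0"
  shows "weighted_interaction w F S R =
    inverse (1 - \<kappa> / 16 * \<sigma>) * remainder (weighted_interaction w F) S R"
proof -
  have "weighted_interaction w F S R =
      weighted_interaction w F (sub1 S) (sub1 R) + remainder (weighted_interaction w F) S R"
    using S(2) R(2) by (intro weighted_interaction_remainder int cont) (simp_all add: double_area_nonzero_iff)
  also have "weighted_interaction w F (sub1 S) (sub1 R) = \<kappa> * \<sigma> / 16 * weighted_interaction w F S R"
    unfolding S(1) R(1) by (rule weighted_interaction_sub1[of F \<sigma> w \<kappa>, OF hom w])
  finally have "weighted_interaction w F S R - \<kappa> * \<sigma> / 16 * weighted_interaction w F S R =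
      remainder (weighted_interaction w F) S R"
    by (metis add_diff_cancel_left')
  then have "(1 - \<kappa> / 16 * \<sigma>) * weighted_interaction w F S R = remainder (weighted_interaction w F) S R"
    by (simp add: left_diff_distrib)
  with nz show ?thesis by (metis mult.assoc left_inverse mult_1)
qed

theorem mainTheorem2:
  fixes F :: "real^3 \<Rightarrow> complex" and s :: "real \<Rightarrow> complex"
    and S R :: triangle
    and p1 p2 p3 q1 q2 q3 p p' :: "real^3"
  assumes homogeneous:
      "\<And>\<alpha> r. \<alpha> \<noteq> 0 \<Longrightarrow> r \<noteq> 0 \<Longrightarrow> F (\<alpha> *\<^sub>R r) = s \<alpha> * F r"
    and S: "S = (p1, p2, p3)" "nondegenerate S"
    and R: "R = (q1, q2, q3)" "nondegenerate R"
    and common_vertex: "p1 = 0" "q1 = 0"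
    and touch: "triangle_set S \<inter> triangle_set R = {0}"
    and integrable:
      "integrable (completion (surface_measure R \<Otimes>\<^sub>M surface_measure S))
         (\<lambda>(x, x'). F (x - x'))"
  shows
    "(1 - 1/16 * s (1/2) \<noteq> 0 \<longrightarrow>
        I_one F S R = inverse (1 - 1/16 * s (1/2)) * remainder (I_one F) S R) \<and>
     (1 - 1/32 * s (1/2) \<noteq> 0 \<longrightarrow>
        I_src p' F S R = inverse (1 - 1/32 * s (1/2)) * remainder (I_src p' F) S R) \<and>
     (1 - 1/32 * s (1/2) \<noteq> 0 \<longrightarrow>
        I_rec p F S R = inverse (1 - 1/32 * s (1/2)) * remainder (I_rec p F) S R) \<and>
     (1 - 1/64 * s (1/2) \<noteq> 0 \<longrightarrow>
        I_src_rec p' p F S R =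
          inverse (1 - 1/64 * s (1/2)) * remainder (I_src_rec p' p F) S R) \<and>
     (\<forall>(A, B) \<in> set (remainder_pairs S R). triangle_set A \<inter> triangle_set B = {})"
proof -
  have S0: "S = (0, p2, p3)" and R0: "R = (0, q2, q3)"
    using S R common_vertex by simp_all
  \<comment> \<open>Homogeneity enters at \<open>\<alpha> = 1/2\<close>, so \<open>\<sigma>\<close>
    becomes \<open>s (1/2)\<close>.\<close>
  note one_touch = weighted_interaction_one_touch[OF S0 S(2) R0 R(2) homogeneous integrable, simplified]
  have I: "I_one F = weighted_interaction (\<lambda>_ _. 1) F"
    "I_src p' F = weighted_interaction (\<lambda>_ x'. complex_of_real (p' \<bullet> x')) F"
    "I_rec p F = weighted_interaction (\<lambda>x _. complex_of_real (p \<bullet> x)) F"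
    "I_src_rec p' p F = weighted_interaction (\<lambda>x x'. complex_of_real (p' \<bullet> x') * complex_of_real (p \<bullet> x)) F"
    by (simp_all add: fun_eq_iff I_one_def I_src_def I_rec_def I_src_rec_def weighted_interaction_def)
  have nonzero: "double_area (0, p2, p3) \<noteq> 0" "double_area (0, q2, q3) \<noteq> 0"
    using S(2) R(2) S0 R0 by (simp_all add: double_area_nonzero_iff)
  note notin = first_vertex_notin_sub[OF nonzero(1), folded S0] first_vertex_notin_sub[OF nonzero(2), folded R0]
  show ?thesis
  proof (intro conjI impI)
    \<comment> \<open>The weight factor \<open>\<kappa>\<close> is 1 for the constant weight and
      gains 1/2 for each linear factor, so \<open>\<kappa> / 16\<close> is 1/16, 1/32, 1/32 and 1/64
      in turn.\<close>
    show "I_one F S R = inverse (1 - 1/16 * s (1/2)) * remainder (I_one F) S R"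
      if "1 - 1/16 * s (1/2) \<noteq> 0"
      unfolding I using that one_touch[of "\<lambda>_ _. 1" 1] by simp
    show "I_src p' F S R = inverse (1 - 1/32 * s (1/2)) * remainder (I_src p' F) S R"
      if "1 - 1/32 * s (1/2) \<noteq> 0"
      unfolding I using that one_touch[of "\<lambda>_ x'. complex_of_real (p' \<bullet> x')" "1/2"]
      by (simp add: continuous_intros)
    show "I_rec p F S R = inverse (1 - 1/32 * s (1/2)) * remainder (I_rec p F) S R"
      if "1 - 1/32 * s (1/2) \<noteq> 0"
      unfolding I using that one_touch[of "\<lambda>x _. complex_of_real (p \<bullet> x)" "1/2"]
      by (simp add: continuous_intros)
    show "I_src_rec p' p F S R = inverse (1 - 1/64 * s (1/2)) * remainder (I_src_rec p' p F) S R"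
      if "1 - 1/64 * s (1/2) \<noteq> 0"
      unfolding I using that
        one_touch[of "\<lambda>x x'. complex_of_real (p' \<bullet> x') * complex_of_real (p \<bullet> x)" "1/4"]
      by (simp add: continuous_intros)
    \<comment> \<open>In the first three pairs the receiver piece misses the origin, in the last
      three the source piece does.\<close>
    show "\<forall>(A, B) \<in> set (remainder_pairs S R). triangle_set A \<inter> triangle_set B = {}"
      using notin
      by (simp add: remainder_pairs_def triangle_sets_disjoint[OF touch] triangle_set_sub_subset)
  qed
qed

end
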